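(* Let $G$ be a finite group and let $p$ be the smallest prime dividing $|\mathrm{Aut}(G)|$. Let $X_G = \{x\in G : C_{\mathrm{Aut}(G)}(x) = \{I\}\}$, where $I$ is the identity element of $\mathrm{Aut}(G)$. Then $$\mathrm{Pr}(G,\mathrm{Aut}(G)) \geq \frac{|L(G)|}{|G|} + \frac{p(|G|-|X_G|-|L(G)|)+|X_G|}{|G||\mathrm{Aut}(G)|}$$ and $$\mathrm{Pr}(G,\mathrm{Aut}(G)) \leq \frac{(p-1)|L(G)|+|G|}{p|G|} - \frac{|X_G|(|\mathrm{Aut}(G)|-p)}{p|G||\mathrm{Aut}(G)|}.$$
   Context: For a finite group $G$ with automorphism group $\mathrm{Aut}(G)$, let $L(G) := \{x\in G : \alpha(x)=x \text{ for all } \alpha\in\mathrm{Aut}(G)\}$, and for $x\in G$ let $C_{\mathrm{Aut}(G)}(x) := \{\alpha\in\mathrm{Aut}(G) : \alpha(x)=x\}$. Also $$\mathrm{Pr}(G,\mathrm{Aut}(G)) := \frac{|\{(x,\alpha)\in G\times \mathrm{Aut}(G) : \alpha(x)=x\}|}{|G||\mathrm{Aut}(G)|}.$$ *)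

theory Defs
  imports Complex_Main "HOL-Algebra.Bij" "HOL-Algebra.Coset" "HOL-Computational_Algebra.Primes"
begin

text \<open>
  The carrier of \<^term>\<open>AutoGroup G\<close> consists of the bijective endomorphisms of the carrier of
  \<^term>\<open>G\<close> that are extensional (take the value \<^term>\<open>undefined\<close> outside the carrier), so each
  automorphism is represented by exactly one function and \<^term>\<open>order (AutoGroup G)\<close> is the
  number of automorphisms.
\<close>

definition absolute_center :: "('a, 'b) monoid_scheme \<Rightarrow> 'a set" where
  "absolute_center G = {x \<in> carrier G. \<forall>\<alpha> \<in> carrier (AutoGroup G). \<alpha> x = x}"

definition aut_centralizer :: "('a, 'b) monoid_scheme \<Rightarrow> 'a \<Rightarrow> ('a \<Rightarrow> 'a) set" where
  "aut_centralizer G x = {\<alpha> \<in> carrier (AutoGroup G). \<alpha> x = x}"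

definition aut_free_points :: "('a, 'b) monoid_scheme \<Rightarrow> 'a set" where
  "aut_free_points G = {x \<in> carrier G. aut_centralizer G x = {\<one>\<^bsub>AutoGroup G\<^esub>}}"

definition aut_comm_prob :: "('a, 'b) monoid_scheme \<Rightarrow> real" where
  "aut_comm_prob G =
     real (card {(x, \<alpha>) \<in> carrier G \<times> carrier (AutoGroup G). \<alpha> x = x}) /
     (real (order G) * real (order (AutoGroup G)))"

end

theory Submission
  imports Defs
begin

text \<open>
  Counting the pairs \<open>(x, \<alpha>)\<close> with \<open>\<alpha> x = x\<close> by their first component, the number of
  pairs is the sum over \<open>x\<close> of the orders of the stabilizers
  \<^term>\<open>aut_centralizer G x\<close>. Write \<open>A\<close> for the automorphism group. Points of
  \<^term>\<open>absolute_center G\<close> contribute \<open>|A|\<close> each, points of \<^term>\<open>aut_free_points G\<close>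
  contribute \<open>1\<close> each, and the two sets are disjoint because \<open>p\<close> divides \<open>|A|\<close>, so that
  \<open>A\<close> is not trivial.

  At every remaining point the stabilizer is a subgroup of \<open>A\<close> that is neither trivial nor
  all of \<open>A\<close>. By Lagrange's theorem its order and its index are divisors of \<open>|A|\<close> greater
  than \<open>1\<close>; every such divisor has a prime factor, which is at least \<open>p\<close>. Hence each remaining
  point contributes between \<open>p\<close> and \<open>|A| / p\<close> (lemmas \<open>smallest_prime_le_divisor\<close> and
  \<open>proper_subgroup_card_bounds\<close>). Summing these contributions gives a lower and an upper bound
  for the number of pairs, and division by \<open>|G| |A|\<close> turns them into the two claimed bounds.
\<close>

lemma smallest_prime_le_divisor:
  fixes p d n :: nat
  assumes least: "\<And>q :: nat. prime q \<Longrightarrow> q dvd n \<Longrightarrow> p \<le> q"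
    and "d dvd n" "d > 1"
  shows "p \<le> d"
proof -
  obtain q where q: "prime q" "q dvd d"
    using \<open>d > 1\<close> prime_factor_nat[of d] by auto
  then have "p \<le> q" using least \<open>d dvd n\<close> dvd_trans by blast
  also have "q \<le> d" using q(2) \<open>d > 1\<close> by (simp add: dvd_imp_le)
  finally show ?thesis .
qed

text \<open>
  Both the order and the index of the subgroup are divisors of the group order, and both exceed
  \<open>1\<close>. The upper bound on the order is the lower bound on the index.
\<close>
lemma (in group) proper_subgroup_card_bounds:
  fixes p :: nat
  assumes fin: "finite (carrier G)"
    and least: "\<And>q :: nat. prime q \<Longrightarrow> q dvd order G \<Longrightarrow> p \<le> q"
    and H: "subgroup H G" "H \<noteq> {\<one>}" "H \<noteq> carrier G"
  shows "p \<le> card H" and "p * card H \<le> order G"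
proof -
  have lag: "card (rcosets H) * card H = order G"
    using H(1) by (rule lagrange)
  have finH: "finite H"
    using fin subgroup.subset[OF H(1)] finite_subset by blast
  have one: "\<one> \<in> H" using H(1) by (rule subgroup.one_closed)
  have "card H \<noteq> 0" using one finH by auto
  moreover have "card H \<noteq> 1" using one H(2) card_1_singletonE by blast
  ultimately have "card H > 1" by linarith
  then show "p \<le> card H"
    using smallest_prime_le_divisor[OF least] lag by (metis dvd_triv_right)
  have "card H < order G"
    using H(3) subgroup.subset[OF H(1)] fin unfolding order_def by (simp add: psubset_card_mono psubsetI)
  then have "card (rcosets H) \<noteq> 0" "card (rcosets H) \<noteq> 1"
    using lag by (metis mult_0 not_less_zero, metis mult_1 less_irrefl)
  then have "card (rcosets H) > 1" by linarith
  then have "p \<le> card (rcosets H)"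
    using smallest_prime_le_divisor[OF least] lag by (metis dvd_triv_left)
  then show "p * card H \<le> order G" using lag by (metis mult_le_mono1)
qed

lemma finite_AutoGroup:
  assumes "finite (carrier G)"
  shows "finite (carrier (AutoGroup G))"
proof (rule finite_subset)
  show "carrier (AutoGroup G) \<subseteq> (carrier G \<rightarrow>\<^sub>E carrier G)"
    by (auto simp: AutoGroup_def auto_def Bij_def PiE_def dest: bij_betw_imp_funcset)
  show "finite (carrier G \<rightarrow>\<^sub>E carrier G)"
    using assms by (intro finite_PiE)
qed

lemma AutoGroup_mult_apply:
  assumes "\<alpha> \<in> carrier (AutoGroup G)" "\<beta> \<in> carrier (AutoGroup G)" "x \<in> carrier G"
  shows "(\<alpha> \<otimes>\<^bsub>AutoGroup G\<^esub> \<beta>) x = \<alpha> (\<beta> x)"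
  using assms by (simp add: AutoGroup_def BijGroup_def auto_def compose_eq)

lemma AutoGroup_one_apply: "x \<in> carrier G \<Longrightarrow> \<one>\<^bsub>AutoGroup G\<^esub> x = x"
  by (simp add: AutoGroup_def BijGroup_def)

lemma (in group) subgroup_aut_centralizer:
  assumes x: "x \<in> carrier G"
  shows "subgroup (aut_centralizer G x) (AutoGroup G)"
proof -
  interpret A: group "AutoGroup G" by (rule AutoGroup)
  show ?thesis
  proof (rule A.subgroupI)
    show "aut_centralizer G x \<noteq> {}"
      using AutoGroup_one_apply[OF x] A.one_closed unfolding aut_centralizer_def by blast
  next
    fix \<alpha> assume "\<alpha> \<in> aut_centralizer G x"
    then have \<alpha>: "\<alpha> \<in> carrier (AutoGroup G)" "\<alpha> x = x" by (auto simp: aut_centralizer_def)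
    have "(inv\<^bsub>AutoGroup G\<^esub> \<alpha>) x = (inv\<^bsub>AutoGroup G\<^esub> \<alpha> \<otimes>\<^bsub>AutoGroup G\<^esub> \<alpha>) x"
      using AutoGroup_mult_apply[OF A.inv_closed[OF \<alpha>(1)] \<alpha>(1) x] \<alpha>(2) by simp
    also have "\<dots> = x" using \<alpha>(1) AutoGroup_one_apply[OF x] by simp
    finally show "inv\<^bsub>AutoGroup G\<^esub> \<alpha> \<in> aut_centralizer G x"
      using \<alpha>(1) by (simp add: aut_centralizer_def)
  qed (auto simp: aut_centralizer_def AutoGroup_mult_apply x)
qed

lemma card_fixing_pairs:
  assumes "finite (carrier G)"
  shows "card {(x, \<alpha>) \<in> carrier G \<times> carrier (AutoGroup G). \<alpha> x = x}
           = (\<Sum>x\<in>carrier G. card (aut_centralizer G x))"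
proof -
  have "{(x, \<alpha>) \<in> carrier G \<times> carrier (AutoGroup G). \<alpha> x = x}
          = (SIGMA x:carrier G. aut_centralizer G x)"
    by (auto simp: aut_centralizer_def)
  then show ?thesis
    using assms finite_AutoGroup[OF assms] by (simp add: card_SigmaI aut_centralizer_def)
qed

lemma absolute_center_iff:
  "x \<in> absolute_center G \<longleftrightarrow> x \<in> carrier G \<and> aut_centralizer G x = carrier (AutoGroup G)"
  by (auto simp: absolute_center_def aut_centralizer_def)

theorem theorem3p4:
  fixes G :: "('a, 'b) monoid_scheme" and p :: nat
  assumes "group G"
    and "finite (carrier G)"
    and "prime p"
    and "p dvd order (AutoGroup G)"
    and "\<And>q :: nat. prime q \<Longrightarrow> q dvd order (AutoGroup G) \<Longrightarrow> p \<le> q"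
  shows "aut_comm_prob G \<ge>
           real (card (absolute_center G)) / real (order G) +
           (real p * (real (order G) - real (card (aut_free_points G))
                        - real (card (absolute_center G)))
             + real (card (aut_free_points G))) /
           (real (order G) * real (order (AutoGroup G)))
       \<and> aut_comm_prob G \<le>
           ((real p - 1) * real (card (absolute_center G)) + real (order G)) /
           (real p * real (order G)) -
           (real (card (aut_free_points G)) * (real (order (AutoGroup G)) - real p)) /
           (real p * real (order G) * real (order (AutoGroup G)))"
proof -
  interpret group G by fact
  interpret A: group "AutoGroup G" by (rule AutoGroup)
  let ?C = "\<lambda>x. card (aut_centralizer G x)"
  define L where "L = absolute_center G"
  define X where "X = aut_free_points G"
  define R where "R = carrier G - L - X"
  define n where "n = order G"
  define a where "a = order (AutoGroup G)"
  have fin: "finite (carrier G)" by fact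
  have finA: "finite (carrier (AutoGroup G))" using fin by (rule finite_AutoGroup)
  have n_pos: "n > 0" using fin by (simp add: n_def order_gt_0_iff_finite)
  have a_pos: "a > 0" using finA by (simp add: a_def A.order_gt_0_iff_finite)
  have "p > 1" using \<open>prime p\<close> by (rule prime_gt_1_nat)
  have "p \<le> a" using \<open>p dvd order (AutoGroup G)\<close> a_pos by (simp add: a_def dvd_imp_le)

  have C_L: "?C x = a" if "x \<in> L" for x
    using that by (simp add: L_def absolute_center_iff a_def order_def)
  have C_X: "?C x = 1" if "x \<in> X" for x
    using that by (simp add: X_def aut_free_points_def)
  have C_R: "p \<le> ?C x" "p * ?C x \<le> a" if "x \<in> R" for x
  proof -
    have x: "x \<in> carrier G" "aut_centralizer G x \<noteq> {\<one>\<^bsub>AutoGroup G\<^esub>}"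
        "aut_centralizer G x \<noteq> carrier (AutoGroup G)"
      using that by (auto simp: R_def L_def X_def absolute_center_iff aut_free_points_def)
    show "p \<le> ?C x" "p * ?C x \<le> a"
      using A.proper_subgroup_card_bounds[OF finA assms(5) subgroup_aut_centralizer[OF x(1)] x(2,3)]
      by (simp_all add: a_def)
  qed

  \<comment> \<open>A common point would have a stabilizer of order both \<open>1\<close> and \<open>a \<ge> p > 1\<close>.\<close>
  have "L \<inter> X = {}" using C_L C_X \<open>p > 1\<close> \<open>p \<le> a\<close> by fastforce
  have sub: "L \<subseteq> carrier G" "X \<subseteq> carrier G"
    by (auto simp: L_def X_def absolute_center_def aut_free_points_def)
  have fins: "finite L" "finite X" "finite R"
    using sub fin finite_subset by (auto simp: R_def)
  have G_eq: "carrier G = (L \<union> X) \<union> R" using sub by (auto simp: R_def)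
  have disj: "(L \<union> X) \<inter> R = {}" by (auto simp: R_def)
  have "order G = card L + card X + card R"
    unfolding order_def by (subst G_eq) (simp add: card_Un_disjoint fins disj \<open>L \<inter> X = {}\<close>)
  then have card_R: "real (card R) = real n - card L - card X" by (simp add: n_def)

  define S where "S = (\<Sum>x\<in>R. ?C x)"
  have "(\<Sum>x\<in>carrier G. ?C x) = (\<Sum>x\<in>L. ?C x) + (\<Sum>x\<in>X. ?C x) + S"
    unfolding S_def by (subst G_eq) (simp add: sum.union_disjoint fins disj \<open>L \<inter> X = {}\<close>)
  also have "\<dots> = card L * a + card X + S" by (simp add: C_L C_X)
  finally have prob: "aut_comm_prob G = (card L * real a + card X + S) / (real n * a)"
    using card_fixing_pairs[OF fin] by (simp add: aut_comm_prob_def n_def a_def)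

  have "card R * p \<le> S"
    using sum_bounded_below[of R p ?C] C_R(1) by (simp add: S_def)
  then have "real (card R * p) \<le> real S" by (rule of_nat_mono)
  then have S_ge: "p * (real n - card X - card L) \<le> real S"
    by (simp add: card_R algebra_simps)
  have "p * S \<le> card R * a"
    using sum_bounded_above[of R "\<lambda>x. p * ?C x" a] C_R(2) by (simp add: S_def sum_distrib_left)
  then have "real (p * S) \<le> real (card R * a)" by (rule of_nat_mono)
  then have S_le: "p * real S \<le> (real n - card L - card X) * a"
    by (simp add: card_R)

  have "real (card L) / n + (p * (real n - card X - card L) + card X) / (real n * a)
      = (card L * real a + card X + p * (real n - card X - card L)) / (real n * a)"
    using n_pos a_pos by (simp add: field_simps)
  also have "\<dots> \<le> aut_comm_prob G"
    unfolding prob using S_ge by (intro divide_right_mono) auto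
  finally have lower: "real (card L) / n + (p * (real n - card X - card L) + card X) / (real n * a)
      \<le> aut_comm_prob G" .

  have "aut_comm_prob G = (p * (card L * real a + card X) + p * real S) / (p * real n * a)"
    unfolding prob using n_pos a_pos \<open>p > 1\<close> by (simp add: field_simps)
  also have "\<dots> \<le> (p * (card L * real a + card X) + (real n - card L - card X) * a) / (p * real n * a)"
    using S_le by (intro divide_right_mono) auto
  also have "\<dots> = ((real p - 1) * card L + n) / (p * real n)
      - (card X * (real a - p)) / (p * real n * a)"
    using n_pos a_pos \<open>p > 1\<close> by (simp add: field_simps)
  finally have upper: "aut_comm_prob G \<le> ((real p - 1) * card L + n) / (p * real n)
      - (card X * (real a - p)) / (p * real n * a)" .

  show ?thesis using lower upper unfolding L_def X_def n_def a_def by blast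
qed

end
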